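(* Let $X=\bigsqcup_{\Omega\in U}\mathcal{B}(\Omega)$ be equipped with the metric $d_X$ induced by the metric $d_U$ and the deformation system $\mathcal{D}$ (see context), and let $K\subset X$ be compact. Then for any continuous mapping $\mathcal{H}:K\to X$ that preserves domains, i.e. $\mathcal{H}(K\cap\mathcal{B}(\Omega))\subset\mathcal{B}(\Omega)$ for every $\Omega\in U$, there exists a unique continuous mapping $\hat{\mathcal{H}}:K\to L^2(\Omega_0)$ (with values in $\mathcal{B}(\Omega_0)\subset L^2(\Omega_0)$), given by $$\hat{\mathcal{H}}(f_\Omega)=\pi_2(\sigma(\mathcal{H}(f_\Omega))),$$ such that $$\mathcal{H}=\sigma^{-1}\circ(\pi_1\circ\sigma,\hat{\mathcal{H}}).$$
   Context: $U$ is a class of bounded domains in $\mathbb{R}^d$ equipped with a metric $d_U$. For a set $\Omega$, $\mathcal{B}(\Omega)$ is the set of bounded Borel functions $\Omega\to\mathbb{R}$, and $\mathcal{B}(\Omega,\mathbb{R}^d)$ the set of bounded Borel maps $\Omega\to\mathbb{R}^d$. Deformation assumption: there is a standard (bounded) domain $\Omega_0\subset\mathbb{R}^d$ and, for every $\Omega\in U$, a bijection $\mathcal{D}[\Omega]:\Omega_0\to\Omega$ with $\mathcal{D}[\Omega]\in\mathcal{B}(\Omega_0,\mathbb{R}^d)$ and $\mathcal{D}[\Omega]^{-1}\in\mathcal{B}(\Omega,\mathbb{R}^d)$, such that the map $\mathcal{D}:U\to\mathcal{B}(\Omega_0,\mathbb{R}^d)\subset L^2(\Omega_0,\mathbb{R}^d)$,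 $\Omega\mapsto\mathcal{D}[\Omega]$, is continuous (from $d_U$ to the $L^2$ norm). The individual maps $\mathcal{D}[\Omega]$ need not be continuous. Metric on $X=\bigsqcup_{\Omega\in U}\mathcal{B}(\Omega)$: for $f_{\Omega_1}\in\mathcal{B}(\Omega_1)$, $f_{\Omega_2}\in\mathcal{B}(\Omega_2)$, $$d_X(f_{\Omega_1},f_{\Omega_2}):=d_U(\Omega_1,\Omega_2)+\|f_{\Omega_1}\circ\mathcal{D}[\Omega_1]-f_{\Omega_2}\circ\mathcal{D}[\Omega_2]\|_{L^2(\Omega_0)}.$$ Elements of $\mathcal{B}(\Omega_0)$ are regarded as elements of $L^2(\Omega_0)$ (identified when equal a.e.), and correspondingly elements $f,g\in\mathcal{B}(\Omega)$ are identified in $X$ when $f\circ\mathcal{D}[\Omega]=g\circ\mathcal{D}[\Omega]$ a.e. on $\Omega_0$. The map $\sigma:X\to U\times\mathcal{B}(\Omega_0)$, $\sigma(f_\Omega)=(\Omega,f_\Omega\circ\mathcal{D}[\Omega])$, is a bijective isometry (for the sum metric with the $L^2(\Omega_0)$ norm on the second factor); $\pi_1:U\times\mathcal{B}(\Omega_0)\to U$ and $\pi_2:U\times\mathcal{B}(\Omega_0)\to\mathcal{B}(\Omega_0)$ are the coordinate projections. *)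

theory Defs
  imports "HOL-Analysis.Analysis"
begin

definition bounded_domain :: "'a::euclidean_space set \<Rightarrow> bool" where
  "bounded_domain \<Omega> \<longleftrightarrow> open \<Omega> \<and> connected \<Omega> \<and> \<Omega> \<noteq> {} \<and> bounded \<Omega>"

text \<open>A function on \<open>\<Omega>\<close> is represented by a total function whose values outside \<open>\<Omega>\<close> are
  irrelevant; they disappear in all the quotients below.\<close>

definition bounded_borel :: "'a::euclidean_space set \<Rightarrow> ('a \<Rightarrow> 'b::euclidean_space) set" where
  "bounded_borel \<Omega> = {f \<in> borel_measurable (restrict_space borel \<Omega>). bounded (f ` \<Omega>)}"


section \<open>The space $L^2(\Omega)$ as a metric space of almost-everywhere classes\<close>

definition L2_fun :: "'a::euclidean_space set \<Rightarrow> ('a \<Rightarrow> 'b::euclidean_space) set" where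
  "L2_fun \<Omega> = {f \<in> borel_measurable (lebesgue_on \<Omega>).
     integrable (lebesgue_on \<Omega>) (\<lambda>x. (norm (f x))\<^sup>2)}"

definition L2_norm :: "'a::euclidean_space set \<Rightarrow> ('a \<Rightarrow> 'b::euclidean_space) \<Rightarrow> real" where
  "L2_norm \<Omega> f = sqrt (\<integral>x. (norm (f x))\<^sup>2 \<partial>lebesgue_on \<Omega>)"

definition L2_rel :: "'a::euclidean_space set \<Rightarrow> (('a \<Rightarrow> 'b::euclidean_space) \<times> ('a \<Rightarrow> 'b)) set" where
  "L2_rel \<Omega> = {(f, g). f \<in> L2_fun \<Omega> \<and> g \<in> L2_fun \<Omega> \<and> (AE x in lebesgue_on \<Omega>. f x = g x)}"

definition L2_space :: "'a::euclidean_space set \<Rightarrow> ('a \<Rightarrow> 'b::euclidean_space) set set" where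
  "L2_space \<Omega> = L2_fun \<Omega> // L2_rel \<Omega>"

definition L2_class :: "'a::euclidean_space set \<Rightarrow> ('a \<Rightarrow> 'b::euclidean_space) \<Rightarrow> ('a \<Rightarrow> 'b) set" where
  "L2_class \<Omega> f = L2_rel \<Omega> `` {f}"

text \<open>The value does not depend on the chosen representatives: lemma \<open>L2_dist_class\<close> below, and
  likewise \<open>X_dist_class\<close> for the metric on \<open>X\<close>.\<close>

definition L2_dist ::
    "'a::euclidean_space set \<Rightarrow> ('a \<Rightarrow> 'b::euclidean_space) set \<Rightarrow> ('a \<Rightarrow> 'b) set \<Rightarrow> real" where
  "L2_dist \<Omega> F G = L2_norm \<Omega> (\<lambda>x. (SOME f. f \<in> F) x - (SOME g. g \<in> G) x)"

abbreviation L2_topology :: "'a::euclidean_space set \<Rightarrow> ('a \<Rightarrow> 'b::euclidean_space) set topology" where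
  "L2_topology \<Omega> \<equiv> Metric_space.mtopology (L2_space \<Omega>) (L2_dist \<Omega>)"

definition bounded_borel_L2 :: "'a::euclidean_space set \<Rightarrow> ('a \<Rightarrow> 'b::euclidean_space) set set" where
  "bounded_borel_L2 \<Omega> = L2_class \<Omega> ` bounded_borel \<Omega>"


section \<open>Deformation systems\<close>

locale deformation_system = Metric_space U dU
  for U :: "'a::euclidean_space set set" and dU :: "'a set \<Rightarrow> 'a set \<Rightarrow> real" +
  fixes \<Omega>0 :: "'a set" and D :: "'a set \<Rightarrow> 'a \<Rightarrow> 'a"
  assumes domain_U: "\<Omega> \<in> U \<Longrightarrow> bounded_domain \<Omega>"
    and domain_\<Omega>0: "bounded_domain \<Omega>0"
    and bij_D: "\<Omega> \<in> U \<Longrightarrow> bij_betw (D \<Omega>) \<Omega>0 \<Omega>"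
    and borel_D: "\<Omega> \<in> U \<Longrightarrow> D \<Omega> \<in> bounded_borel \<Omega>0"
    and borel_D_inv: "\<Omega> \<in> U \<Longrightarrow> inv_into \<Omega>0 (D \<Omega>) \<in> bounded_borel \<Omega>"
    and continuous_D: "continuous_map mtopology (L2_topology \<Omega>0) (\<lambda>\<Omega>. L2_class \<Omega>0 (D \<Omega>))"

text \<open>Identification of elements of \<open>\<B>(\<Omega>)\<close>. A point of the disjoint union \<open>X\<close> is a pair of a domain
  \<open>\<Omega>\<close> and a class of bounded Borel functions on \<open>\<Omega>\<close>; the subset \<open>\<B>(\<Omega>)\<close> of \<open>X\<close> is \<open>X_fibre \<Omega>0 D \<Omega>\<close>.\<close>

definition deform_rel ::
    "'a::euclidean_space set \<Rightarrow> ('a set \<Rightarrow> 'a \<Rightarrow> 'a) \<Rightarrow> 'a set \<Rightarrow> (('a \<Rightarrow> real) \<times> ('a \<Rightarrow> real)) set" where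
  "deform_rel \<Omega>0 D \<Omega> = {(f, g). f \<in> bounded_borel \<Omega> \<and> g \<in> bounded_borel \<Omega> \<and>
     (AE x in lebesgue_on \<Omega>0. f (D \<Omega> x) = g (D \<Omega> x))}"

definition X_fibre ::
    "'a::euclidean_space set \<Rightarrow> ('a set \<Rightarrow> 'a \<Rightarrow> 'a) \<Rightarrow> 'a set \<Rightarrow> ('a set \<times> ('a \<Rightarrow> real) set) set" where
  "X_fibre \<Omega>0 D \<Omega> = {\<Omega>} \<times> (bounded_borel \<Omega> // deform_rel \<Omega>0 D \<Omega>)"

definition X_space ::
    "'a::euclidean_space set set \<Rightarrow> 'a set \<Rightarrow> ('a set \<Rightarrow> 'a \<Rightarrow> 'a) \<Rightarrow> ('a set \<times> ('a \<Rightarrow> real) set) set" where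
  "X_space U \<Omega>0 D = (\<Union>\<Omega>\<in>U. X_fibre \<Omega>0 D \<Omega>)"

definition X_dist ::
    "('a::euclidean_space set \<Rightarrow> 'a set \<Rightarrow> real) \<Rightarrow> 'a set \<Rightarrow> ('a set \<Rightarrow> 'a \<Rightarrow> 'a) \<Rightarrow>
     'a set \<times> ('a \<Rightarrow> real) set \<Rightarrow> 'a set \<times> ('a \<Rightarrow> real) set \<Rightarrow> real" where
  "X_dist dU \<Omega>0 D p q = dU (fst p) (fst q) +
     L2_norm \<Omega>0 (\<lambda>x. (SOME f. f \<in> snd p) (D (fst p) x) - (SOME g. g \<in> snd q) (D (fst q) x))"

abbreviation X_topology ::
    "'a::euclidean_space set set \<Rightarrow> ('a set \<Rightarrow> 'a set \<Rightarrow> real) \<Rightarrow> 'a set \<Rightarrow> ('a set \<Rightarrow> 'a \<Rightarrow> 'a) \<Rightarrow>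
     ('a set \<times> ('a \<Rightarrow> real) set) topology" where
  "X_topology U dU \<Omega>0 D \<equiv> Metric_space.mtopology (X_space U \<Omega>0 D) (X_dist dU \<Omega>0 D)"

definition X_sigma ::
    "'a::euclidean_space set \<Rightarrow> ('a set \<Rightarrow> 'a \<Rightarrow> 'a) \<Rightarrow>
     'a set \<times> ('a \<Rightarrow> real) set \<Rightarrow> 'a set \<times> ('a \<Rightarrow> real) set" where
  "X_sigma \<Omega>0 D p = (fst p, \<Union>f\<in>snd p. L2_class \<Omega>0 (\<lambda>x. f (D (fst p) x)))"


text \<open>Continuous maps \<open>h : K \<rightarrow> L\<^sup>2(\<Omega>0)\<close> with values in \<open>\<B>(\<Omega>0)\<close> and \<open>H = \<sigma>\<inverse> \<circ> (\<pi>\<^sub>1 \<circ> \<sigma>, h)\<close>. They are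
  taken extensional outside \<open>K\<close>, so that equality of maps on \<open>K\<close> is equality in HOL.\<close>

definition domain_factor ::
    "'a::euclidean_space set set \<Rightarrow> ('a set \<Rightarrow> 'a set \<Rightarrow> real) \<Rightarrow> 'a set \<Rightarrow> ('a set \<Rightarrow> 'a \<Rightarrow> 'a) \<Rightarrow>
     ('a set \<times> ('a \<Rightarrow> real) set) set \<Rightarrow>
     ('a set \<times> ('a \<Rightarrow> real) set \<Rightarrow> 'a set \<times> ('a \<Rightarrow> real) set) \<Rightarrow>
     ('a set \<times> ('a \<Rightarrow> real) set \<Rightarrow> ('a \<Rightarrow> real) set) \<Rightarrow> bool" where
  "domain_factor U dU \<Omega>0 D K H h \<longleftrightarrow>
     h \<in> K \<rightarrow>\<^sub>E bounded_borel_L2 \<Omega>0 \<and>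
     continuous_map (subtopology (X_topology U dU \<Omega>0 D) K) (L2_topology \<Omega>0) h \<and>
     (\<forall>p\<in>K. H p = inv_into (X_space U \<Omega>0 D) (X_sigma \<Omega>0 D) (fst (X_sigma \<Omega>0 D p), h p))"


section \<open>The quotient constructions are well defined\<close>

lemma equiv_L2_rel: "equiv (L2_fun \<Omega>) (L2_rel \<Omega>)"
proof (rule equivI)
  show "L2_rel \<Omega> \<subseteq> L2_fun \<Omega> \<times> L2_fun \<Omega>" by (auto simp: L2_rel_def)
  show "refl_on (L2_fun \<Omega>) (L2_rel \<Omega>)" by (auto simp: refl_on_def L2_rel_def)
  show "sym (L2_rel \<Omega>)" by (auto simp: sym_def L2_rel_def elim: eventually_elim2)
  show "trans (L2_rel \<Omega>)"
  proof (rule transI)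
    fix f g h assume fg: "(f, g) \<in> L2_rel \<Omega>" and gh: "(g, h) \<in> L2_rel \<Omega>"
    then have "AE x in lebesgue_on \<Omega>. f x = g x" "AE x in lebesgue_on \<Omega>. g x = h x"
      by (simp_all add: L2_rel_def)
    then have "AE x in lebesgue_on \<Omega>. f x = h x"
      by eventually_elim simp
    with fg gh show "(f, h) \<in> L2_rel \<Omega>" by (simp add: L2_rel_def)
  qed
qed

lemma L2_class_in: "f \<in> L2_fun \<Omega> \<Longrightarrow> L2_class \<Omega> f \<in> L2_space \<Omega>"
  by (simp add: L2_class_def L2_space_def quotientI)

lemma L2_class_self: "f \<in> L2_fun \<Omega> \<Longrightarrow> f \<in> L2_class \<Omega> f"
  by (simp add: L2_class_def L2_rel_def)

lemma L2_spaceE: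
  assumes "F \<in> L2_space \<Omega>" obtains f where "f \<in> L2_fun \<Omega>" "F = L2_class \<Omega> f"
  using assms unfolding L2_space_def L2_class_def by (auto elim: quotientE)

lemma L2_class_eq_iff:
  assumes "f \<in> L2_fun \<Omega>" "g \<in> L2_fun \<Omega>"
  shows "L2_class \<Omega> f = L2_class \<Omega> g \<longleftrightarrow> (AE x in lebesgue_on \<Omega>. f x = g x)"
  using eq_equiv_class_iff[OF equiv_L2_rel assms] assms by (simp add: L2_class_def L2_rel_def)

lemma L2_norm_cong_AE:
  assumes "f \<in> borel_measurable (lebesgue_on \<Omega>)" "g \<in> borel_measurable (lebesgue_on \<Omega>)"
    "AE x in lebesgue_on \<Omega>. f x = g x"
  shows "L2_norm \<Omega> f = L2_norm \<Omega> g"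
proof -
  have "(\<integral>x. (norm (f x))\<^sup>2 \<partial>lebesgue_on \<Omega>) = (\<integral>x. (norm (g x))\<^sup>2 \<partial>lebesgue_on \<Omega>)"
    using assms by (intro integral_cong_AE) auto
  then show ?thesis by (simp add: L2_norm_def)
qed

lemma L2_dist_class:
  assumes "f \<in> L2_fun \<Omega>" "g \<in> L2_fun \<Omega>"
  shows "L2_dist \<Omega> (L2_class \<Omega> f) (L2_class \<Omega> g) = L2_norm \<Omega> (\<lambda>x. f x - g x)"
proof -
  define f' where "f' = (SOME f'. f' \<in> L2_class \<Omega> f)"
  define g' where "g' = (SOME g'. g' \<in> L2_class \<Omega> g)"
  have f': "f' \<in> L2_class \<Omega> f" and g': "g' \<in> L2_class \<Omega> g"
    unfolding f'_def g'_def using L2_class_self assms by (metis someI)+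
  then have "L2_norm \<Omega> (\<lambda>x. f' x - g' x) = L2_norm \<Omega> (\<lambda>x. f x - g x)"
    by (intro L2_norm_cong_AE) (auto simp: L2_class_def L2_rel_def L2_fun_def elim: eventually_elim2)
  then show ?thesis by (simp add: L2_dist_def f'_def g'_def)
qed

lemma L2_fun_diff:
  assumes "f \<in> L2_fun \<Omega>" "g \<in> L2_fun \<Omega>"
  shows "(\<lambda>x. f x - g x) \<in> L2_fun \<Omega>"
proof -
  have "integrable (lebesgue_on \<Omega>) (\<lambda>x. (norm (f x - g x))\<^sup>2)"
  proof (rule Bochner_Integration.integrable_bound)
    show "integrable (lebesgue_on \<Omega>) (\<lambda>x. 2 * (norm (f x))\<^sup>2 + 2 * (norm (g x))\<^sup>2)"
      using assms by (auto simp: L2_fun_def)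
    show "(\<lambda>x. (norm (f x - g x))\<^sup>2) \<in> borel_measurable (lebesgue_on \<Omega>)"
      using assms by (auto simp: L2_fun_def)
    show "AE x in lebesgue_on \<Omega>. norm ((norm (f x - g x))\<^sup>2)
        \<le> norm (2 * (norm (f x))\<^sup>2 + 2 * (norm (g x))\<^sup>2)"
    proof (rule AE_I2)
      fix x
      have "(norm (f x - g x))\<^sup>2 \<le> (norm (f x) + norm (g x))\<^sup>2"
        by (intro power_mono norm_triangle_ineq4) auto
      also have "\<dots> \<le> 2 * (norm (f x))\<^sup>2 + 2 * (norm (g x))\<^sup>2"
        using sum_squares_bound[of "norm (f x)" "norm (g x)"] by (simp add: power2_sum)
      finally show "norm ((norm (f x - g x))\<^sup>2) \<le> norm (2 * (norm (f x))\<^sup>2 + 2 * (norm (g x))\<^sup>2)"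
        by simp
    qed
  qed
  then show ?thesis using assms by (auto simp: L2_fun_def)
qed

lemma L2_norm_eq_0_iff:
  assumes "f \<in> L2_fun \<Omega>"
  shows "L2_norm \<Omega> f = 0 \<longleftrightarrow> (AE x in lebesgue_on \<Omega>. f x = 0)"
  using assms integral_nonneg_eq_0_iff_AE[of "lebesgue_on \<Omega>" "\<lambda>x. (norm (f x))\<^sup>2"]
  by (simp add: L2_norm_def L2_fun_def)

lemma L2_norm_nonneg: "0 \<le> L2_norm \<Omega> f"
  by (simp add: L2_norm_def)

lemma L2_norm_power2: "(L2_norm \<Omega> f)\<^sup>2 = (\<integral>x. (norm (f x))\<^sup>2 \<partial>lebesgue_on \<Omega>)"
  by (simp add: L2_norm_def)

lemma L2_norm_diff_triangle:
  assumes f: "f \<in> L2_fun \<Omega>" and g: "g \<in> L2_fun \<Omega>"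
  shows "L2_norm \<Omega> (\<lambda>x. f x - g x) \<le> L2_norm \<Omega> f + L2_norm \<Omega> g"
proof -
  let ?a = "L2_norm \<Omega> f" and ?b = "L2_norm \<Omega> g"
  have fm: "f \<in> borel_measurable (lebesgue_on \<Omega>)" and gm: "g \<in> borel_measurable (lebesgue_on \<Omega>)"
    using f g by (auto simp: L2_fun_def)
  consider "?a = 0" | "?b = 0" | "?a > 0" "?b > 0"
    using L2_norm_nonneg[of \<Omega> f] L2_norm_nonneg[of \<Omega> g] by fastforce
  then show ?thesis
  proof cases
    case 1
    then have "AE x in lebesgue_on \<Omega>. f x = 0" using L2_norm_eq_0_iff[OF f] by simp
    then have "L2_norm \<Omega> (\<lambda>x. f x - g x) = L2_norm \<Omega> (\<lambda>x. - g x)"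
      using fm gm by (intro L2_norm_cong_AE) (auto elim: eventually_elim2)
    also have "\<dots> = ?b" by (simp add: L2_norm_def)
    finally show ?thesis using 1 by simp
  next
    case 2
    then have "AE x in lebesgue_on \<Omega>. g x = 0" using L2_norm_eq_0_iff[OF g] by simp
    then have "L2_norm \<Omega> (\<lambda>x. f x - g x) = ?a"
      using fm gm by (intro L2_norm_cong_AE) (auto elim: eventually_elim2)
    then show ?thesis using 2 by simp
  next
    case 3
    define s where "s = ?b / ?a"
    have s: "s > 0" using 3 by (simp add: s_def)
    have pt: "(norm (f x - g x))\<^sup>2 \<le> (1 + s) * (norm (f x))\<^sup>2 + (1 + 1/s) * (norm (g x))\<^sup>2" for x
    proof -
      have "(norm (f x - g x))\<^sup>2 \<le> (norm (f x) + norm (g x))\<^sup>2"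
        by (intro power_mono norm_triangle_ineq4) auto
      also have "\<dots> \<le> (1 + s) * (norm (f x))\<^sup>2 + (1 + 1/s) * (norm (g x))\<^sup>2"
      proof -
        have "0 \<le> (s * norm (f x) - norm (g x))\<^sup>2 / s" using s by simp
        then show ?thesis using s by (simp add: power2_eq_square field_simps)
      qed
      finally show ?thesis .
    qed
    have "(L2_norm \<Omega> (\<lambda>x. f x - g x))\<^sup>2
        \<le> (\<integral>x. (1 + s) * (norm (f x))\<^sup>2 + (1 + 1/s) * (norm (g x))\<^sup>2 \<partial>lebesgue_on \<Omega>)"
      unfolding L2_norm_power2 using f g L2_fun_diff[OF f g] pt
      by (intro integral_mono) (auto simp: L2_fun_def)
    also have "\<dots> = (1 + s) * ?a\<^sup>2 + (1 + 1/s) * ?b\<^sup>2"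
      unfolding L2_norm_power2 using f g by (subst Bochner_Integration.integral_add) (auto simp: L2_fun_def)
    also have "\<dots> = ?a\<^sup>2 + (s * ?a) * ?a + ?b\<^sup>2 + (?b / s) * ?b"
      by (simp add: power2_eq_square algebra_simps)
    also have "\<dots> = (?a + ?b)\<^sup>2"
    proof -
      have "s * ?a = ?b" "?b / s = ?a" using 3 by (simp_all add: s_def)
      then show ?thesis by (simp add: power2_eq_square algebra_simps)
    qed
    finally show ?thesis by (rule power2_le_imp_le) (use 3 in simp)
  qed
qed

lemma L2_norm_minus_commute: "L2_norm \<Omega> (\<lambda>x. f x - g x) = L2_norm \<Omega> (\<lambda>x. g x - f x)"
  by (simp add: L2_norm_def norm_minus_commute)

lemma L2_norm_triangle:
  assumes "f \<in> L2_fun \<Omega>" "g \<in> L2_fun \<Omega>" "h \<in> L2_fun \<Omega>"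
  shows "L2_norm \<Omega> (\<lambda>x. f x - h x) \<le> L2_norm \<Omega> (\<lambda>x. f x - g x) + L2_norm \<Omega> (\<lambda>x. g x - h x)"
  using L2_norm_diff_triangle[of "\<lambda>x. f x - g x" \<Omega> "\<lambda>x. h x - g x"] assms
  by (simp add: L2_fun_diff L2_norm_minus_commute[of \<Omega> h g])

lemma Metric_space_L2: "Metric_space (L2_space \<Omega>) (L2_dist \<Omega>)"
proof
  show "0 \<le> L2_dist \<Omega> F G" for F G :: "('a \<Rightarrow> 'b) set"
    by (simp add: L2_dist_def L2_norm_nonneg)
  show "L2_dist \<Omega> F G = L2_dist \<Omega> G F" for F G :: "('a \<Rightarrow> 'b) set"
    unfolding L2_dist_def by (rule L2_norm_minus_commute)
next
  fix F G :: "('a \<Rightarrow> 'b) set" assume "F \<in> L2_space \<Omega>" "G \<in> L2_space \<Omega>"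
  then obtain f g where "f \<in> L2_fun \<Omega>" "F = L2_class \<Omega> f" "g \<in> L2_fun \<Omega>" "G = L2_class \<Omega> g"
    by (metis L2_spaceE)
  then show "L2_dist \<Omega> F G = 0 \<longleftrightarrow> F = G"
    by (simp add: L2_dist_class L2_norm_eq_0_iff L2_fun_diff L2_class_eq_iff)
next
  fix F G H :: "('a \<Rightarrow> 'b) set"
  assume "F \<in> L2_space \<Omega>" "G \<in> L2_space \<Omega>" "H \<in> L2_space \<Omega>"
  then obtain f g h where "f \<in> L2_fun \<Omega>" "F = L2_class \<Omega> f" "g \<in> L2_fun \<Omega>" "G = L2_class \<Omega> g"
    "h \<in> L2_fun \<Omega>" "H = L2_class \<Omega> h"
    by (metis L2_spaceE)
  then show "L2_dist \<Omega> F H \<le> L2_dist \<Omega> F G + L2_dist \<Omega> G H"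
    by (simp add: L2_dist_class L2_norm_triangle)
qed

lemma bounded_borel_subset_L2_fun:
  assumes "bounded_domain \<Omega>" "f \<in> bounded_borel \<Omega>"
  shows "f \<in> L2_fun \<Omega>"
proof -
  have \<Omega>: "\<Omega> \<in> lmeasurable"
    using assms by (simp add: bounded_domain_def lmeasurable_open)
  have "(\<lambda>x. x) \<in> lebesgue_on \<Omega> \<rightarrow>\<^sub>M restrict_space borel \<Omega>"
    by (intro measurable_restrict_space3 measurable_completion) auto
  then have f: "f \<in> borel_measurable (lebesgue_on \<Omega>)"
    using assms measurable_compose unfolding bounded_borel_def by blast
  obtain B where B: "\<And>x. x \<in> \<Omega> \<Longrightarrow> norm (f x) \<le> B"
    using assms by (auto simp: bounded_borel_def bounded_iff)
  interpret finite_measure "lebesgue_on \<Omega>"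
    using \<Omega> by (rule finite_measure_lebesgue_on)
  have "integrable (lebesgue_on \<Omega>) (\<lambda>x. (norm (f x))\<^sup>2)"
  proof (rule integrable_const_bound)
    show "AE x in lebesgue_on \<Omega>. norm ((norm (f x))\<^sup>2) \<le> B\<^sup>2"
      using B by (intro AE_I2) (simp add: power_mono)
  qed (use f in simp)
  with f show ?thesis by (simp add: L2_fun_def)
qed

lemma equiv_deform_rel: "equiv (bounded_borel \<Omega>) (deform_rel \<Omega>0 D \<Omega>)"
proof (rule equivI)
  show "deform_rel \<Omega>0 D \<Omega> \<subseteq> bounded_borel \<Omega> \<times> bounded_borel \<Omega>" by (auto simp: deform_rel_def)
  show "refl_on (bounded_borel \<Omega>) (deform_rel \<Omega>0 D \<Omega>)" by (auto simp: refl_on_def deform_rel_def)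
  show "sym (deform_rel \<Omega>0 D \<Omega>)" by (auto simp: sym_def deform_rel_def elim: eventually_elim2)
  show "trans (deform_rel \<Omega>0 D \<Omega>)"
  proof (rule transI)
    fix f g h assume fg: "(f, g) \<in> deform_rel \<Omega>0 D \<Omega>" and gh: "(g, h) \<in> deform_rel \<Omega>0 D \<Omega>"
    then have "AE x in lebesgue_on \<Omega>0. f (D \<Omega> x) = g (D \<Omega> x)" "AE x in lebesgue_on \<Omega>0. g (D \<Omega> x) = h (D \<Omega> x)"
      by (simp_all add: deform_rel_def)
    then have "AE x in lebesgue_on \<Omega>0. f (D \<Omega> x) = h (D \<Omega> x)"
      by eventually_elim simp
    with fg gh show "(f, h) \<in> deform_rel \<Omega>0 D \<Omega>" by (simp add: deform_rel_def)
  qed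
qed

lemma X_spaceE:
  assumes "p \<in> X_space U \<Omega>0 D"
  obtains \<Omega> f where "\<Omega> \<in> U" "f \<in> bounded_borel \<Omega>" "p = (\<Omega>, deform_rel \<Omega>0 D \<Omega> `` {f})"
  using assms unfolding X_space_def X_fibre_def by (auto elim!: quotientE)

lemma X_spaceI:
  "\<Omega> \<in> U \<Longrightarrow> f \<in> bounded_borel \<Omega> \<Longrightarrow> (\<Omega>, deform_rel \<Omega>0 D \<Omega> `` {f}) \<in> X_space U \<Omega>0 D"
  unfolding X_space_def X_fibre_def by (auto intro: quotientI)

context deformation_system
begin

lemma pullback_bounded_borel:
  assumes "\<Omega> \<in> U" "f \<in> bounded_borel \<Omega>"
  shows "(\<lambda>x. f (D \<Omega> x)) \<in> bounded_borel \<Omega>0"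
proof -
  have D: "D \<Omega> ` \<Omega>0 = \<Omega>" using bij_D[OF assms(1)] by (simp add: bij_betw_def)
  have "D \<Omega> \<in> restrict_space borel \<Omega>0 \<rightarrow>\<^sub>M restrict_space borel \<Omega>"
    using borel_D[OF assms(1)] D
    by (intro measurable_restrict_space2) (auto simp: bounded_borel_def space_restrict_space)
  moreover have "(\<lambda>x. f (D \<Omega> x)) ` \<Omega>0 = f ` \<Omega>" using D by force
  ultimately show ?thesis using assms by (auto simp: bounded_borel_def intro: measurable_compose)
qed

lemma pushforward_bounded_borel:
  assumes "\<Omega> \<in> U" "f \<in> bounded_borel \<Omega>0"
  shows "(\<lambda>y. f (inv_into \<Omega>0 (D \<Omega>) y)) \<in> bounded_borel \<Omega>"
proof -
  let ?E = "inv_into \<Omega>0 (D \<Omega>)"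
  have E: "?E ` \<Omega> = \<Omega>0"
    using bij_betw_inv_into[OF bij_D[OF assms(1)]] by (simp add: bij_betw_def)
  have "?E \<in> restrict_space borel \<Omega> \<rightarrow>\<^sub>M restrict_space borel \<Omega>0"
    using borel_D_inv[OF assms(1)] E
    by (intro measurable_restrict_space2) (auto simp: bounded_borel_def space_restrict_space)
  moreover have "(\<lambda>x. f (?E x)) ` \<Omega> = f ` \<Omega>0" using E by force
  ultimately show ?thesis using assms by (auto simp: bounded_borel_def intro: measurable_compose)
qed

lemma pullback_L2_fun:
  "\<Omega> \<in> U \<Longrightarrow> f \<in> bounded_borel \<Omega> \<Longrightarrow> (\<lambda>x. f (D \<Omega> x)) \<in> L2_fun \<Omega>0"
  using bounded_borel_subset_L2_fun domain_\<Omega>0 pullback_bounded_borel by blast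

lemma X_sigma_class:
  assumes "\<Omega> \<in> U" "f \<in> bounded_borel \<Omega>"
  shows "X_sigma \<Omega>0 D (\<Omega>, deform_rel \<Omega>0 D \<Omega> `` {f}) = (\<Omega>, L2_class \<Omega>0 (\<lambda>x. f (D \<Omega> x)))"
proof -
  have "L2_class \<Omega>0 (\<lambda>x. g (D \<Omega> x)) = L2_class \<Omega>0 (\<lambda>x. f (D \<Omega> x))"
    if "(f, g) \<in> deform_rel \<Omega>0 D \<Omega>" for g
    using that assms by (subst L2_class_eq_iff) (auto simp: pullback_L2_fun deform_rel_def elim: eventually_elim2)
  moreover have "(f, f) \<in> deform_rel \<Omega>0 D \<Omega>" using assms by (simp add: deform_rel_def)
  ultimately have "(\<Union>g\<in>deform_rel \<Omega>0 D \<Omega> `` {f}. L2_class \<Omega>0 (\<lambda>x. g (D \<Omega> x)))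
      = L2_class \<Omega>0 (\<lambda>x. f (D \<Omega> x))"
    by blast
  then show ?thesis by (simp only: X_sigma_def fst_conv snd_conv)
qed

lemma X_dist_class:
  assumes "\<Omega>1 \<in> U" "f \<in> bounded_borel \<Omega>1" "\<Omega>2 \<in> U" "g \<in> bounded_borel \<Omega>2"
  shows "X_dist dU \<Omega>0 D (\<Omega>1, deform_rel \<Omega>0 D \<Omega>1 `` {f}) (\<Omega>2, deform_rel \<Omega>0 D \<Omega>2 `` {g})
    = dU \<Omega>1 \<Omega>2 + L2_norm \<Omega>0 (\<lambda>x. f (D \<Omega>1 x) - g (D \<Omega>2 x))"
proof -
  define f' where "f' = (SOME f'. f' \<in> deform_rel \<Omega>0 D \<Omega>1 `` {f})"
  define g' where "g' = (SOME g'. g' \<in> deform_rel \<Omega>0 D \<Omega>2 `` {g})"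
  have "f \<in> deform_rel \<Omega>0 D \<Omega>1 `` {f}" "g \<in> deform_rel \<Omega>0 D \<Omega>2 `` {g}"
    using assms by (auto simp: deform_rel_def)
  then have "f' \<in> deform_rel \<Omega>0 D \<Omega>1 `` {f}" and "g' \<in> deform_rel \<Omega>0 D \<Omega>2 `` {g}"
    unfolding f'_def g'_def by (metis someI)+
  then have r: "f' \<in> bounded_borel \<Omega>1" "AE x in lebesgue_on \<Omega>0. f (D \<Omega>1 x) = f' (D \<Omega>1 x)"
    "g' \<in> bounded_borel \<Omega>2" "AE x in lebesgue_on \<Omega>0. g (D \<Omega>2 x) = g' (D \<Omega>2 x)"
    by (auto simp: deform_rel_def)
  have "(\<lambda>x. f (D \<Omega>1 x) - g (D \<Omega>2 x)) \<in> L2_fun \<Omega>0" "(\<lambda>x. f' (D \<Omega>1 x) - g' (D \<Omega>2 x)) \<in> L2_fun \<Omega>0"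
    using assms r by (auto intro!: L2_fun_diff pullback_L2_fun)
  moreover have "AE x in lebesgue_on \<Omega>0. f' (D \<Omega>1 x) - g' (D \<Omega>2 x) = f (D \<Omega>1 x) - g (D \<Omega>2 x)"
    using r(2,4) by eventually_elim simp
  ultimately have "L2_norm \<Omega>0 (\<lambda>x. f' (D \<Omega>1 x) - g' (D \<Omega>2 x)) = L2_norm \<Omega>0 (\<lambda>x. f (D \<Omega>1 x) - g (D \<Omega>2 x))"
    by (intro L2_norm_cong_AE) (simp_all add: L2_fun_def)
  then show ?thesis by (simp add: X_dist_def f'_def g'_def)
qed

lemma X_sigma_isometry:
  assumes "p \<in> X_space U \<Omega>0 D" "q \<in> X_space U \<Omega>0 D"
  shows "X_dist dU \<Omega>0 D p q = dU (fst (X_sigma \<Omega>0 D p)) (fst (X_sigma \<Omega>0 D q))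
    + L2_dist \<Omega>0 (snd (X_sigma \<Omega>0 D p)) (snd (X_sigma \<Omega>0 D q))"
proof -
  obtain \<Omega>1 f where f: "\<Omega>1 \<in> U" "f \<in> bounded_borel \<Omega>1" "p = (\<Omega>1, deform_rel \<Omega>0 D \<Omega>1 `` {f})"
    using assms(1) by (rule X_spaceE)
  obtain \<Omega>2 g where g: "\<Omega>2 \<in> U" "g \<in> bounded_borel \<Omega>2" "q = (\<Omega>2, deform_rel \<Omega>0 D \<Omega>2 `` {g})"
    using assms(2) by (rule X_spaceE)
  show ?thesis
    using f g by (simp add: X_dist_class X_sigma_class L2_dist_class pullback_L2_fun)
qed

lemma bij_betw_X_sigma: "bij_betw (X_sigma \<Omega>0 D) (X_space U \<Omega>0 D) (U \<times> bounded_borel_L2 \<Omega>0)"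
  unfolding bij_betw_def
proof
  show "inj_on (X_sigma \<Omega>0 D) (X_space U \<Omega>0 D)"
  proof
    fix p q assume p: "p \<in> X_space U \<Omega>0 D" and q: "q \<in> X_space U \<Omega>0 D"
      and eq: "X_sigma \<Omega>0 D p = X_sigma \<Omega>0 D q"
    obtain \<Omega> f where f: "\<Omega> \<in> U" "f \<in> bounded_borel \<Omega>" "p = (\<Omega>, deform_rel \<Omega>0 D \<Omega> `` {f})"
      using p by (rule X_spaceE)
    obtain \<Omega>' g where g: "\<Omega>' \<in> U" "g \<in> bounded_borel \<Omega>'" "q = (\<Omega>', deform_rel \<Omega>0 D \<Omega>' `` {g})"
      using q by (rule X_spaceE)
    have "\<Omega>' = \<Omega>" using eq f g by (simp add: X_sigma_class)
    moreover from this have "AE x in lebesgue_on \<Omega>0. f (D \<Omega> x) = g (D \<Omega> x)"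
      using eq f g by (simp add: X_sigma_class L2_class_eq_iff pullback_L2_fun)
    ultimately have "(f, g) \<in> deform_rel \<Omega>0 D \<Omega>" using f g by (simp add: deform_rel_def)
    then show "p = q"
      using f g \<open>\<Omega>' = \<Omega>\<close> equiv_class_eq[OF equiv_deform_rel] by simp
  qed
  show "X_sigma \<Omega>0 D ` X_space U \<Omega>0 D = U \<times> bounded_borel_L2 \<Omega>0"
  proof
    show "X_sigma \<Omega>0 D ` X_space U \<Omega>0 D \<subseteq> U \<times> bounded_borel_L2 \<Omega>0"
      by (auto elim!: X_spaceE simp: X_sigma_class bounded_borel_L2_def pullback_bounded_borel)
    show "U \<times> bounded_borel_L2 \<Omega>0 \<subseteq> X_sigma \<Omega>0 D ` X_space U \<Omega>0 D"
    proof
      fix y assume "y \<in> U \<times> (bounded_borel_L2 \<Omega>0 :: ('a \<Rightarrow> real) set set)"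
      then obtain \<Omega> f where y: "\<Omega> \<in> U" "f \<in> bounded_borel \<Omega>0" "y = (\<Omega>, L2_class \<Omega>0 f)"
        by (auto simp: bounded_borel_L2_def)
      define g where "g = (\<lambda>y. f (inv_into \<Omega>0 (D \<Omega>) y))"
      have g: "g \<in> bounded_borel \<Omega>" using pushforward_bounded_borel y by (simp add: g_def)
      have "g (D \<Omega> x) = f x" if "x \<in> \<Omega>0" for x
        using bij_D[OF y(1)] that by (simp add: g_def bij_betw_inv_into_left)
      then have "L2_class \<Omega>0 (\<lambda>x. g (D \<Omega> x)) = L2_class \<Omega>0 f"
        using y g by (subst L2_class_eq_iff)
          (auto simp: pullback_L2_fun bounded_borel_subset_L2_fun domain_\<Omega>0 intro!: AE_I2)
      then have "y = X_sigma \<Omega>0 D (\<Omega>, deform_rel \<Omega>0 D \<Omega> `` {g})"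
        using y X_sigma_class[OF y(1) g] by simp
      then show "y \<in> X_sigma \<Omega>0 D ` X_space U \<Omega>0 D"
        using X_spaceI[OF y(1) g] by (rule image_eqI)
    qed
  qed
qed

lemma Metric_space_X: "Metric_space (X_space U \<Omega>0 D) (X_dist dU \<Omega>0 D)"
proof -
  interpret L2: Metric_space "L2_space \<Omega>0 :: ('a \<Rightarrow> real) set set" "L2_dist \<Omega>0"
    by (rule Metric_space_L2)
  let ?s = "X_sigma \<Omega>0 D"
  have in_sp: "fst (?s p) \<in> U" "snd (?s p) \<in> L2_space \<Omega>0" if "p \<in> X_space U \<Omega>0 D" for p
    using that by (auto elim!: X_spaceE simp: X_sigma_class L2_class_in pullback_L2_fun)
  show ?thesis
  proof
    show "0 \<le> X_dist dU \<Omega>0 D p q" for p q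
      by (simp add: X_dist_def L2_norm_nonneg)
    show "X_dist dU \<Omega>0 D p q = X_dist dU \<Omega>0 D q p" for p q
      unfolding X_dist_def by (intro arg_cong2[of _ _ _ _ "(+)"] commute L2_norm_minus_commute)
  next
    fix p q assume pq: "p \<in> X_space U \<Omega>0 D" "q \<in> X_space U \<Omega>0 D"
    have "X_dist dU \<Omega>0 D p q = 0 \<longleftrightarrow> ?s p = ?s q"
      using pq in_sp by (simp add: X_sigma_isometry add_nonneg_eq_0_iff prod_eq_iff)
    then show "X_dist dU \<Omega>0 D p q = 0 \<longleftrightarrow> p = q"
      using pq bij_betw_X_sigma by (auto simp: bij_betw_def inj_on_def)
  next
    fix p q r assume pqr: "p \<in> X_space U \<Omega>0 D" "q \<in> X_space U \<Omega>0 D" "r \<in> X_space U \<Omega>0 D"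
    then show "X_dist dU \<Omega>0 D p r \<le> X_dist dU \<Omega>0 D p q + X_dist dU \<Omega>0 D q r"
      using triangle[of "fst (?s p)" "fst (?s q)" "fst (?s r)"]
        L2.triangle[of "snd (?s p)" "snd (?s q)" "snd (?s r)"] in_sp
      by (simp add: X_sigma_isometry)
  qed
qed

end

end

theory Submission
  imports Defs
begin

text \<open>The map \<open>X_sigma\<close> is a bijective isometry onto \<open>U\<close> times
  \<open>bounded_borel_L2 \<Omega>0\<close>, so a map into \<open>X\<close> amounts to a pair of
  coordinate maps. For a domain-preserving \<open>H\<close> the first coordinate is that of the
  argument, and only the second carries information. Applying \<open>X_sigma\<close> to the
  factorization equation therefore forces \<open>h\<close> to be the second coordinate of
  \<open>X_sigma\<close> after \<open>H\<close>; conversely this \<open>h\<close> satisfies the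
  equation, and it is continuous because the second coordinate is
  (\<open>continuous_map_snd_X_sigma\<close>). Both directions are joined in
  \<open>domain_factor_iff\<close>.\<close>

context deformation_system
begin

lemma X_sigma_in:
  "p \<in> X_space U \<Omega>0 D \<Longrightarrow> X_sigma \<Omega>0 D p \<in> U \<times> bounded_borel_L2 \<Omega>0"
  using bij_betwE[OF bij_betw_X_sigma] by blast

lemma bounded_borel_L2_subset_L2_space: "bounded_borel_L2 \<Omega>0 \<subseteq> L2_space \<Omega>0"
  using bounded_borel_subset_L2_fun domain_\<Omega>0 L2_class_in by (auto simp: bounded_borel_L2_def)

lemma fst_X_sigma [simp]: "fst (X_sigma \<Omega>0 D p) = fst p"
  by (simp add: X_sigma_def)

text \<open>The map is 1-Lipschitz: by the isometry, its \<open>L2_dist\<close> is one of the two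
  nonnegative summands of \<open>X_dist\<close>.\<close>

lemma continuous_map_snd_X_sigma:
  "continuous_map (X_topology U dU \<Omega>0 D) (L2_topology \<Omega>0) (\<lambda>p. snd (X_sigma \<Omega>0 D p))"
proof -
  let ?\<pi> = "\<lambda>p. snd (X_sigma \<Omega>0 D p)"
  interpret X: Metric_space "X_space U \<Omega>0 D" "X_dist dU \<Omega>0 D"
    by (rule Metric_space_X)
  have in_L2: "?\<pi> p \<in> L2_space \<Omega>0" if "p \<in> X_space U \<Omega>0 D" for p
    using X_sigma_in[OF that] bounded_borel_L2_subset_L2_space by auto
  have le: "L2_dist \<Omega>0 (?\<pi> p) (?\<pi> q) \<le> X_dist dU \<Omega>0 D p q"
    if "p \<in> X_space U \<Omega>0 D" "q \<in> X_space U \<Omega>0 D" for p q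
    using that by (simp add: X_sigma_isometry)
  show ?thesis
    unfolding X.metric_continuous_map[OF Metric_space_L2]
  proof (intro conjI ballI allI impI)
    show "?\<pi> ` X_space U \<Omega>0 D \<subseteq> L2_space \<Omega>0" using in_L2 by blast
    show "\<exists>\<delta>>0. \<forall>q. q \<in> X_space U \<Omega>0 D \<and> X_dist dU \<Omega>0 D p q < \<delta> \<longrightarrow> L2_dist \<Omega>0 (?\<pi> p) (?\<pi> q) < \<epsilon>"
      if "p \<in> X_space U \<Omega>0 D" "\<epsilon> > 0" for p and \<epsilon> :: real
      \<comment> \<open>The choice \<delta> = \<epsilon> works, by the Lipschitz bound.\<close>
      using that le order.strict_trans1 by blast
  qed
qed

text \<open>An equivalence settles existence and uniqueness together: the left-to-right direction
  gives uniqueness, the other existence. The restriction to \<open>K\<close> matches the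
  extensionality built into \<open>domain_factor\<close>.\<close>

lemma domain_factor_iff:
  assumes K: "K \<subseteq> X_space U \<Omega>0 D" and H: "H ` K \<subseteq> X_space U \<Omega>0 D"
    and fst_H: "\<And>p. p \<in> K \<Longrightarrow> fst (H p) = fst p"
    and cont: "continuous_map (subtopology (X_topology U dU \<Omega>0 D) K) (X_topology U dU \<Omega>0 D) H"
  shows "domain_factor U dU \<Omega>0 D K H h \<longleftrightarrow> h = (\<lambda>p\<in>K. snd (X_sigma \<Omega>0 D (H p)))"
proof
  let ?X = "X_space U \<Omega>0 D" and ?s = "X_sigma \<Omega>0 D"
  assume h: "domain_factor U dU \<Omega>0 D K H h"
  show "h = (\<lambda>p\<in>K. snd (?s (H p)))"
  proof (rule extensionalityI)
    show "h \<in> extensional K" using h by (auto simp: domain_factor_def PiE_def)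
    show "h p = (\<lambda>p\<in>K. snd (?s (H p))) p" if p: "p \<in> K" for p
    proof -
      \<comment> \<open>The pair must lie in the image of \<open>X_sigma\<close>, since only there
        is \<open>inv_into\<close> a right inverse.\<close>
      have "(fst (?s p), h p) \<in> U \<times> bounded_borel_L2 \<Omega>0"
        using h p X_sigma_in[OF subsetD[OF K p]] by (auto simp: domain_factor_def mem_Times_iff)
      then have "?s (inv_into ?X ?s (fst (?s p), h p)) = (fst (?s p), h p)"
        by (rule bij_betw_inv_into_right[OF bij_betw_X_sigma])
      then show ?thesis using h p by (simp add: domain_factor_def)
    qed
  qed simp
next
  let ?X = "X_space U \<Omega>0 D" and ?s = "X_sigma \<Omega>0 D"
  let ?h = "\<lambda>p\<in>K. snd (?s (H p))"
  have "?h \<in> K \<rightarrow>\<^sub>E bounded_borel_L2 \<Omega>0"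
  proof (rule restrict_PiE_iff[THEN iffD2], rule ballI)
    fix p assume "p \<in> K"
    then have "?s (H p) \<in> U \<times> bounded_borel_L2 \<Omega>0" using H X_sigma_in by blast
    then show "snd (?s (H p)) \<in> bounded_borel_L2 \<Omega>0" by (rule SigmaE) simp
  qed
  moreover have "continuous_map (subtopology (X_topology U dU \<Omega>0 D) K) (L2_topology \<Omega>0) ?h"
    using continuous_map_compose[OF cont continuous_map_snd_X_sigma]
    by (rule continuous_map_eq) auto
  moreover have "H p = inv_into ?X ?s (fst (?s p), ?h p)" if p: "p \<in> K" for p
  proof -
    \<comment> \<open>Preservation of domains enters here: \<open>p\<close> and \<open>H p\<close>
      share the first coordinate.\<close>
    have "(fst (?s p), ?h p) = ?s (H p)" using p fst_H by (simp add: prod_eq_iff)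
    moreover have "inv_into ?X ?s (?s (H p)) = H p"
      using H p by (intro bij_betw_inv_into_left[OF bij_betw_X_sigma]) blast
    ultimately show ?thesis by metis
  qed
  moreover assume "h = ?h"
  ultimately show "domain_factor U dU \<Omega>0 D K H h"
    unfolding domain_factor_def by blast
qed

end

theorem theorem2:
  fixes U :: "(real ^ 'd) set set" and dU :: "(real ^ 'd) set \<Rightarrow> (real ^ 'd) set \<Rightarrow> real"
    and \<Omega>0 :: "(real ^ 'd) set" and D :: "(real ^ 'd) set \<Rightarrow> real ^ 'd \<Rightarrow> real ^ 'd"
    and K :: "((real ^ 'd) set \<times> (real ^ 'd \<Rightarrow> real) set) set"
    and H :: "(real ^ 'd) set \<times> (real ^ 'd \<Rightarrow> real) set \<Rightarrow> (real ^ 'd) set \<times> (real ^ 'd \<Rightarrow> real) set"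
  assumes "deformation_system U dU \<Omega>0 D"
    and "compactin (X_topology U dU \<Omega>0 D) K"
    and "continuous_map (subtopology (X_topology U dU \<Omega>0 D) K) (X_topology U dU \<Omega>0 D) H"
    and "\<forall>\<Omega>\<in>U. H ` (K \<inter> X_fibre \<Omega>0 D \<Omega>) \<subseteq> X_fibre \<Omega>0 D \<Omega>"
  shows "\<exists>h. domain_factor U dU \<Omega>0 D K H h \<and>
    (\<forall>p\<in>K. h p = snd (X_sigma \<Omega>0 D (H p))) \<and>
    (\<forall>g. domain_factor U dU \<Omega>0 D K H g \<longrightarrow> g = h)"
proof -
  interpret deformation_system U dU \<Omega>0 D by (rule assms(1))
  interpret X: Metric_space "X_space U \<Omega>0 D" "X_dist dU \<Omega>0 D"
    by (rule Metric_space_X)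
  have K: "K \<subseteq> X_space U \<Omega>0 D"
    using compactin_subset_topspace[OF assms(2)] by simp
  have fibre: "H p \<in> X_space U \<Omega>0 D \<and> fst (H p) = fst p" if p: "p \<in> K" for p
  proof -
    \<comment> \<open>The fibres cover \<open>X\<close>, so the fibrewise hypothesis on
      \<open>H\<close> applies to every point of \<open>K\<close>.\<close>
    obtain \<Omega> where \<Omega>: "\<Omega> \<in> U" "p \<in> X_fibre \<Omega>0 D \<Omega>"
      using p K by (auto simp: X_space_def)
    then have "H p \<in> X_fibre \<Omega>0 D \<Omega>" using assms(4) p by blast
    then show ?thesis using \<Omega> by (auto simp: X_space_def X_fibre_def)
  qed
  have "domain_factor U dU \<Omega>0 D K H h \<longleftrightarrow> h = (\<lambda>p\<in>K. snd (X_sigma \<Omega>0 D (H p)))" for h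
    using K fibre assms(3) by (intro domain_factor_iff) auto
  then show ?thesis by simp
qed

end
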